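(* Let $G$ be the graph of an orthogonal array $\mathrm{OA}(k,m)$. The VC-dimension of $G$ is at most $k(k-1)$.
   Context: All graphs are finite and simple. An orthogonal array $\mathrm{OA}(k,m)$ is a $k\times m^2$ matrix with entries in $[m]=\{1,\dots,m\}$ such that, in any $2\times m^2$ submatrix, all possible ordered pairs in $[m]\times[m]$ appear as columns. The graph of an $\mathrm{OA}(k,m)$ has the $m^2$ columns of the array as vertices, and two distinct columns are adjacent if and only if they agree in some row (coordinate). The VC-dimension of a graph $G$ is the maximum size of a set $S\subseteq V(G)$ that is shattered, meaning that for every $A\subseteq S$ there is a vertex $u\in V(G)$ (possibly $u\in S$) with $N(u)\cap S=A$, where $N(u)$ is the open neighborhood of $u$.
   Formalization: The cases k = 1 with m ≥ 2 and k = 2 with m ≥ 4 are excluded, because the bound k(k-1) fails there for every orthogonal array: the VC-dimension is at least 1 and at least 3 respectively. *)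

theory Defs
  imports "Jordan_Normal_Form.Matrix" "Graph_Theory.Pair_Digraph"
begin

(* Rows and columns are indexed from 0, as usual for matrices; the entries are from {1..m}.
   Taking the two rows of the submatrix in either order makes no difference. *)
definition orthogonal_array :: "nat \<Rightarrow> nat \<Rightarrow> nat mat \<Rightarrow> bool" where
  "orthogonal_array k m M \<longleftrightarrow>
     M \<in> carrier_mat k (m\<^sup>2) \<and> elements_mat M \<subseteq> {1..m} \<and>
     (\<forall>i<k. \<forall>i'<k. i \<noteq> i' \<longrightarrow>
        (\<forall>a\<in>{1..m}. \<forall>b\<in>{1..m}. \<exists>j<m\<^sup>2. M $$ (i, j) = a \<and> M $$ (i', j) = b))"

(* An undirected simple graph is a symmetric loop-free digraph (locale pair_graph).
   The vertices are the column indices, so that there are always m^2 of them, even if two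
   columns carry the same entries. *)
definition oa_graph :: "'a mat \<Rightarrow> nat pair_pre_digraph" where
  "oa_graph M = \<lparr> pverts = {..<dim_col M},
     parcs = {(u, v). u < dim_col M \<and> v < dim_col M \<and> u \<noteq> v \<and>
                      (\<exists>i<dim_row M. M $$ (i, u) = M $$ (i, v))} \<rparr>"

definition open_nbhd :: "'v pair_pre_digraph \<Rightarrow> 'v \<Rightarrow> 'v set" where
  "open_nbhd G u = {v. (u, v) \<in> parcs G}"

definition shattered :: "'v pair_pre_digraph \<Rightarrow> 'v set \<Rightarrow> bool" where
  "shattered G S \<longleftrightarrow>
     S \<subseteq> pverts G \<and> (\<forall>A\<subseteq>S. \<exists>u\<in>pverts G. open_nbhd G u \<inter> S = A)"

(* On nat, Sup is Max for finite nonempty sets. If G is finite and has a vertex, the set below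
   is finite and contains 0; for the graph without vertices the value is Sup {} = 0. *)
definition VC_dim :: "'v pair_pre_digraph \<Rightarrow> nat" where
  "VC_dim G = Sup {card S |S. shattered G S}"

lemma pair_graph_oa_graph: "pair_graph (oa_graph M)"
proof -
  have "parcs (oa_graph M) \<subseteq> {..<dim_col M} \<times> {..<dim_col M}"
    by (auto simp: oa_graph_def)
  then have "finite (parcs (oa_graph M))"
    by (rule finite_subset) simp
  then show ?thesis
    unfolding oa_graph_def
    by unfold_locales (auto simp: arcs_ends_def arc_to_ends_def with_proj_def symmetric_def intro!: symI)
qed

lemma VC_dim_eq_Max:
  assumes "finite (pverts G)" "pverts G \<noteq> {}"
  shows "VC_dim G = Max {card S |S. shattered G S}"
proof -
  have "shattered G {}"
    using assms(2) by (auto simp: shattered_def)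
  then have "{card S |S. shattered G S} \<noteq> {}"
    by blast
  then show ?thesis
    unfolding VC_dim_def Sup_nat_def by (simp only: if_False)
qed

lemma shattered_le_VC_dim:
  assumes "finite (pverts G)" "shattered G S"
  shows "card S \<le> VC_dim G"
proof -
  have "{card S |S. shattered G S} \<subseteq> {..card (pverts G)}"
    using assms(1) by (auto simp: shattered_def intro: card_mono)
  then have "bdd_above {card S |S. shattered G S}"
    by (meson bdd_above_Iic bdd_above_mono)
  then show ?thesis
    unfolding VC_dim_def using assms(2) by (intro cSup_upper) auto
qed

(* The next two facts show that the bound k * (k - 1) on the VC-dimension fails
   for every orthogonal array with k = 1, m \<ge> 2 or k = 2, m \<ge> 4. *)
lemma VC_dim_one_row:
  assumes M: "orthogonal_array 1 m M" and m: "2 \<le> m"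
  shows "1 \<le> VC_dim (oa_graph M)"
proof -
  have dims: "dim_row M = 1" "dim_col M = m\<^sup>2" and el: "elements_mat M \<subseteq> {1..m}"
    using M by (auto simp: orthogonal_array_def)
  have "(\<lambda>j. M $$ (0, j)) ` {..<m\<^sup>2} \<subseteq> {1..m}"
    using dims elements_matI[of M 1 "m\<^sup>2" 0] el by auto
  then have "card ((\<lambda>j. M $$ (0, j)) ` {..<m\<^sup>2}) \<le> m"
    using card_mono[of "{1..m}"] by fastforce
  also have "m < m\<^sup>2" using m by (simp add: power2_eq_square)
  finally have "\<not> inj_on (\<lambda>j. M $$ (0, j)) {..<m\<^sup>2}"
    by (intro pigeonhole) simp
  then obtain u v where uv: "u < m\<^sup>2" "v < m\<^sup>2" "u \<noteq> v" "M $$ (0, u) = M $$ (0, v)"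
    by (auto simp: inj_on_def)
  have "\<exists>w\<in>pverts (oa_graph M). open_nbhd (oa_graph M) w \<inter> {u} = A" if "A \<subseteq> {u}" for A
  proof (cases "A = {}")
    case True
    then show ?thesis using uv dims
      by (intro bexI[of _ u]) (auto simp: oa_graph_def open_nbhd_def)
  next
    case False
    then show ?thesis using uv dims that
      by (intro bexI[of _ v]) (auto simp: oa_graph_def open_nbhd_def)
  qed
  then have "shattered (oa_graph M) {u}"
    using uv dims by (auto simp: shattered_def oa_graph_def)
  from shattered_le_VC_dim[OF _ this] show ?thesis
    by (simp add: oa_graph_def)
qed

lemma VC_dim_two_rows:
  assumes M: "orthogonal_array 2 m M" and m: "4 \<le> m"
  shows "3 \<le> VC_dim (oa_graph M)"
proof -
  have dims: "dim_row M = 2" "dim_col M = m\<^sup>2"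
    using M by (auto simp: orthogonal_array_def)
  have "\<exists>j<m\<^sup>2. M $$ (0, j) = a \<and> M $$ (1, j) = b" if "a \<in> {1..m}" "b \<in> {1..m}" for a b
    using M that by (simp add: orthogonal_array_def)
  then obtain c where c: "\<And>a b. a \<in> {1..m} \<Longrightarrow> b \<in> {1..m} \<Longrightarrow>
      c a b < m\<^sup>2 \<and> M $$ (0, c a b) = a \<and> M $$ (1, c a b) = b"
    by metis
  let ?G = "oa_graph M" and ?S = "{c 1 1, c 1 2, c 1 3}"
  have V: "c a b \<in> pverts ?G" if "a \<in> {1..m}" "b \<in> {1..m}" for a b
    using c[OF that] dims by (simp add: oa_graph_def)
  have eq: "c a b = c a' b' \<longleftrightarrow> a = a' \<and> b = b'"
    if "a \<in> {1..m}" "b \<in> {1..m}" "a' \<in> {1..m}" "b' \<in> {1..m}" for a b a' b'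
    using c that by metis
  have N: "c a' b' \<in> open_nbhd ?G (c a b) \<longleftrightarrow> (a, b) \<noteq> (a', b') \<and> (a = a' \<or> b = b')"
    if "a \<in> {1..m}" "b \<in> {1..m}" "a' \<in> {1..m}" "b' \<in> {1..m}" for a b a' b'
    using c[of a b] c[of a' b'] that eq[of a b a' b'] dims
    by (auto simp: oa_graph_def open_nbhd_def numeral_2_eq_2 less_Suc_eq)
  have S: "\<exists>u\<in>pverts ?G. open_nbhd ?G u \<inter> ?S = A"
    if "a \<in> {1..m}" "b \<in> {1..m}" "open_nbhd ?G (c a b) \<inter> ?S = A" for a b A
    using V that by blast
  have "\<exists>u\<in>pverts ?G. open_nbhd ?G u \<inter> ?S = A" if "A \<subseteq> ?S" for A
  proof -
    have "A \<in> Pow ?S" using that by simp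
    then consider "A = {}" | "A = {c 1 1}" | "A = {c 1 2}" | "A = {c 1 3}"
      | "A = {c 1 2, c 1 3}" | "A = {c 1 1, c 1 3}" | "A = {c 1 1, c 1 2}" | "A = ?S"
      unfolding Pow_insert Pow_empty image_Un image_insert image_empty
        Un_iff insert_iff empty_iff by argo
    then show ?thesis
    proof cases
      case 1 then show ?thesis using m by (intro S[of 2 4]) (simp_all add: N Int_insert_right)
    next
      case 2 then show ?thesis using m by (intro S[of 2 1]) (simp_all add: N Int_insert_right)
    next
      case 3 then show ?thesis using m by (intro S[of 2 2]) (simp_all add: N Int_insert_right)
    next
      case 4 then show ?thesis using m by (intro S[of 2 3]) (simp_all add: N Int_insert_right)
    next
      case 5 then show ?thesis using m by (intro S[of 1 1]) (simp_all add: N Int_insert_right)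
    next
      case 6 then show ?thesis using m by (intro S[of 1 2]) (simp_all add: N Int_insert_right)
    next
      case 7 then show ?thesis using m by (intro S[of 1 3]) (simp_all add: N Int_insert_right)
    next
      case 8 then show ?thesis using m by (intro S[of 1 4]) (simp_all add: N Int_insert_right)
    qed
  qed
  then have "shattered ?G ?S"
    using V m by (auto simp: shattered_def)
  from shattered_le_VC_dim[OF _ this] have "card ?S \<le> VC_dim ?G"
    by (simp add: oa_graph_def)
  moreover have "card ?S = 3"
    using m by (simp add: eq)
  ultimately show ?thesis by simp
qed

end

(* Two columns that agree in two different rows are equal. So the columns with a fixed entry in
   a fixed row form a clique (a "line"), and a column off a line has at most k - 1 neighbours on it.
   Suppose S is shattered with more than k (k - 1) elements, and let u be adjacent to all of S.
   By pigeonhole, one of the k lines through u contains a set C of at least k elements of S.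
   Any column adjacent to all of C then lies on that line. Omitting two elements of C
   shows that C has at most k + 1 elements, so for k \<ge> 3 there are at least k elements of S off
   the line. Fix one of them, x; realising the traces C \<union> {x, y} for all y in S - C gives k
   distinct neighbours of x on the line, a contradiction. For k = 2, the trace C is realised only
   by a column on the line other than u and outside C, but the line has at most 3 columns. *)
theory Submission
  imports Defs
begin

lemma VC_dim_leI:
  assumes "\<And>S. shattered G S \<Longrightarrow> card S \<le> n"
  shows "VC_dim G \<le> n"
\<comment> \<open>\<open>cSup_least\<close> needs a nonempty set; in a graph without vertices not
  even \<open>{}\<close> is shattered.\<close>
proof (cases "{card S |S. shattered G S} = {}")
  case True
  then show ?thesis unfolding VC_dim_def True by simp
next
  case False
  then show ?thesis unfolding VC_dim_def by (rule cSup_least) (use assms in auto)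
qed

locale oa =
  fixes k m :: nat and M :: "nat mat"
  assumes oa: "orthogonal_array k m M"
begin

definition line :: "nat \<Rightarrow> nat \<Rightarrow> nat set" where
  "line i a = {v. v < m\<^sup>2 \<and> M $$ (i, v) = a}"

abbreviation nbhd :: "nat \<Rightarrow> nat set" where
  "nbhd \<equiv> open_nbhd (oa_graph M)"

lemma dims [simp]: "dim_row M = k" "dim_col M = m\<^sup>2"
  using oa by (auto simp: orthogonal_array_def)

lemma pverts_oa_graph [simp]: "pverts (oa_graph M) = {..<m\<^sup>2}"
  by (simp add: oa_graph_def)

lemma in_nbhd_iff:
  "v \<in> nbhd u \<longleftrightarrow> u < m\<^sup>2 \<and> v < m\<^sup>2 \<and> u \<noteq> v \<and> (\<exists>i<k. M $$ (i, u) = M $$ (i, v))"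
  by (auto simp: open_nbhd_def oa_graph_def)

lemma finite_line [simp]: "finite (line i a)"
  by (rule finite_subset[of _ "{..<m\<^sup>2}"]) (auto simp: line_def)

lemma shattered_subset: "shattered (oa_graph M) S \<Longrightarrow> S \<subseteq> {..<m\<^sup>2}"
  by (simp add: shattered_def)

lemma shattered_finite: "shattered (oa_graph M) S \<Longrightarrow> finite S"
  by (meson shattered_subset finite_lessThan finite_subset)

lemma shatteredE:
  assumes "shattered (oa_graph M) S" "A \<subseteq> S"
  obtains u where "u < m\<^sup>2" "nbhd u \<inter> S = A"
  using assms unfolding shattered_def by (metis pverts_oa_graph lessThan_iff)

lemma line_clique:
  "i < k \<Longrightarrow> u \<in> line i a \<Longrightarrow> v \<in> line i a \<Longrightarrow> u \<noteq> v \<Longrightarrow> v \<in> nbhd u"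
  by (auto simp: line_def in_nbhd_iff)

text \<open>Rows \<open>i\<close> and \<open>i'\<close> give a map from the \<open>m\<^sup>2\<close>
  columns onto the \<open>m\<^sup>2\<close> pairs of entries; a surjection between finite sets of
  equal size is injective.\<close>

lemma columns_eqI:
  assumes "i < k" "i' < k" "i \<noteq> i'" "u < m\<^sup>2" "v < m\<^sup>2"
    and "M $$ (i, u) = M $$ (i, v)" "M $$ (i', u) = M $$ (i', v)"
  shows "u = v"
proof -
  let ?f = "\<lambda>j. (M $$ (i, j), M $$ (i', j))"
  have "{1..m} \<times> {1..m} \<subseteq> ?f ` {..<m\<^sup>2}"
  proof clarify
    fix a b assume "a \<in> {1..m}" "b \<in> {1..m}"
    then obtain j where "j < m\<^sup>2" "M $$ (i, j) = a" "M $$ (i', j) = b"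
      using oa assms(1-3) unfolding orthogonal_array_def by blast
    then show "(a, b) \<in> ?f ` {..<m\<^sup>2}"
      by (intro image_eqI[of _ _ j]) simp_all
  qed
  then have "card ({1..m} \<times> {1..m}) \<le> card (?f ` {..<m\<^sup>2})"
    by (intro card_mono) auto
  then have "card (?f ` {..<m\<^sup>2}) = card {..<m\<^sup>2}"
    using card_image_le[of "{..<m\<^sup>2}" ?f] by (simp add: power2_eq_square)
  then have "inj_on ?f {..<m\<^sup>2}"
    by (intro eq_card_imp_inj_on) auto
  then show ?thesis
    by (rule inj_onD) (use assms in auto)
qed

text \<open>A column on the line is determined by its entry in any second row, and that entry has
  \<open>m\<close> possible values.\<close>

lemma card_line_le:
  assumes "i < k" "2 \<le> k"
  shows "card (line i a) \<le> m"
proof -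
  obtain i' where i': "i' < k" "i' \<noteq> i"
    using assms by (metis Suc_1 less_2_cases_iff less_le_trans lessI zero_neq_one)
  have "inj_on (\<lambda>v. M $$ (i', v)) (line i a)"
    using columns_eqI[of i i'] assms i' by (auto simp: inj_on_def line_def)
  moreover have "(\<lambda>v. M $$ (i', v)) ` line i a \<subseteq> {1..m}"
    using oa i' elements_matI[of M k "m\<^sup>2" i'] by (auto simp: orthogonal_array_def line_def)
  ultimately show ?thesis
    using card_inj_on_le[of _ "line i a" "{1..m}"] by simp
qed

text \<open>Send each neighbour of \<open>w\<close> on the line to a row where it agrees with
  \<open>w\<close>. This row is not \<open>i\<close>, as \<open>w\<close> is off the line, and two
  neighbours with the same row would agree both there and in row \<open>i\<close>.\<close>

lemma card_nbhd_line_le: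
  assumes "i < k" "w \<notin> line i a"
  shows "card (nbhd w \<inter> line i a) \<le> k - 1"
proof -
  have "\<exists>j. j < k \<and> j \<noteq> i \<and> M $$ (j, w) = M $$ (j, v)" if "v \<in> nbhd w \<inter> line i a" for v
  proof -
    have "w < m\<^sup>2" "M $$ (i, v) = a" "\<exists>j<k. M $$ (j, w) = M $$ (j, v)"
      using that by (simp_all add: in_nbhd_iff line_def)
    moreover from this have "M $$ (i, w) \<noteq> M $$ (i, v)"
      using assms(2) by (simp add: line_def)
    ultimately show ?thesis by metis
  qed
  then obtain f where f: "\<And>v. v \<in> nbhd w \<inter> line i a \<Longrightarrow>
      f v < k \<and> f v \<noteq> i \<and> M $$ (f v, w) = M $$ (f v, v)"
    by metis
  have "inj_on f (nbhd w \<inter> line i a)"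
  proof (rule inj_onI)
    fix v v' assume v: "v \<in> nbhd w \<inter> line i a" "v' \<in> nbhd w \<inter> line i a" and eq: "f v = f v'"
    have "M $$ (f v, v) = M $$ (f v, v')"
      using f[OF v(1)] f[OF v(2)] eq by metis
    moreover have "M $$ (i, v) = M $$ (i, v')" "v < m\<^sup>2" "v' < m\<^sup>2"
      using v by (simp_all add: line_def)
    ultimately show "v = v'"
      using columns_eqI[of i "f v"] f[OF v(1)] assms(1) by metis
  qed
  moreover have "f ` (nbhd w \<inter> line i a) \<subseteq> {..<k} - {i}"
    using f by auto
  ultimately have "card (nbhd w \<inter> line i a) \<le> card ({..<k} - {i})"
    by (intro card_inj_on_le) auto
  then show ?thesis using assms by simp
qed

lemma nbhd_supset_in_line:
  assumes "i < k" "C \<subseteq> line i a" "k \<le> card C" "C \<subseteq> nbhd w"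
  shows "w \<in> line i a"
proof (rule ccontr)
  assume "w \<notin> line i a"
  then have "card (nbhd w \<inter> line i a) \<le> k - 1"
    using card_nbhd_line_le assms(1) by blast
  moreover have "card C \<le> card (nbhd w \<inter> line i a)"
    using assms by (intro card_mono) auto
  ultimately show False using assms by linarith
qed

lemma exists_rich_line:
  assumes sh: "shattered (oa_graph M) S" and big: "k * (k - 1) < card S"
  obtains i u where "i < k" "u < m\<^sup>2" "S \<subseteq> nbhd u" "k \<le> card (S \<inter> line i (M $$ (i, u)))"
proof -
  obtain u where u: "u < m\<^sup>2" "nbhd u \<inter> S = S"
    using shatteredE[OF sh] by blast
  let ?C = "\<lambda>i. S \<inter> line i (M $$ (i, u))"
  have "\<exists>i<k. k \<le> card (?C i)"
  proof (rule ccontr)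
    assume "\<not> ?thesis"
    then have small: "card (?C i) \<le> k - 1" if "i < k" for i
      using that by (metis Suc_pred' less_Suc_eq_le not_le_imp_less gr_implies_not0 neq0_conv)
    have "S \<subseteq> (\<Union>i<k. ?C i)"
    proof
      fix s assume "s \<in> S"
      then have "s \<in> nbhd u" using u by blast
      then show "s \<in> (\<Union>i<k. ?C i)"
        using \<open>s \<in> S\<close> by (force simp: in_nbhd_iff line_def)
    qed
    then have "card S \<le> card (\<Union>i<k. ?C i)"
      by (intro card_mono) auto
    also have "\<dots> \<le> (\<Sum>i<k. card (?C i))"
      by (intro card_UN_le) auto
    also have "\<dots> \<le> k * (k - 1)"
      using sum_bounded_above[of "{..<k}" "\<lambda>i. card (?C i)" "k - 1"] small by simp
    finally show False using big by simp
  qed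
  then show thesis using that u by blast
qed

lemma card_shattered_line_le:
  assumes sh: "shattered (oa_graph M) S" and "i < k"
  shows "card (S \<inter> line i a) \<le> k + 1"
proof (rule ccontr)
  assume "\<not> ?thesis"
  then have big: "k + 2 \<le> card (S \<inter> line i a)" by simp
  \<comment> \<open>Two elements, because \<open>w\<close> may itself be one of the omitted ones and
    is not its own neighbour; the other is then adjacent to a \<open>w\<close> on the line.\<close>
  then obtain T where T: "T \<subseteq> S \<inter> line i a" "card T = 2"
    by (metis obtain_subset_with_card_n le_add2 order_trans)
  obtain w where w: "nbhd w \<inter> S = S \<inter> line i a - T"
    using shatteredE[OF sh, of "S \<inter> line i a - T"] by blast
  have "w \<notin> line i a"
  proof
    assume "w \<in> line i a"
    moreover obtain t where "t \<in> T" "t \<noteq> w"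
      using T(2) by (auto simp: card_2_iff)
    ultimately show False
      using line_clique[OF \<open>i < k\<close>, of w a t] T w by blast
  qed
  then have "card (nbhd w \<inter> line i a) \<le> k - 1"
    using card_nbhd_line_le \<open>i < k\<close> by blast
  moreover have "card (S \<inter> line i a - T) \<le> card (nbhd w \<inter> line i a)"
    using w by (intro card_mono) auto
  moreover have "card (S \<inter> line i a - T) = card (S \<inter> line i a) - 2"
    using T card_Diff_subset[of T "S \<inter> line i a"] finite_subset[OF T(1)] by simp
  ultimately show False using big \<open>i < k\<close> by linarith
qed

lemma card_shattered_off_line_less:
  assumes sh: "shattered (oa_graph M) S" and i: "i < k"
    and rich: "k \<le> card (S \<inter> line i a)"
  shows "card (S - line i a) < k"
proof (cases "S - line i a = {}")
  case True
  then show ?thesis using i by (simp only: True card.empty)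
next
  case False
  then obtain x where x: "x \<in> S - line i a" by blast
  let ?C = "S \<inter> line i a"
  \<comment> \<open>The choice \<open>y = x\<close> is included, so there is one trace for every
    element off the line.\<close>
  have "\<exists>w. nbhd w \<inter> S = ?C \<union> {x, y}" if "y \<in> S - line i a" for y
    using shatteredE[OF sh, of "?C \<union> {x, y}"] that x by blast
  then obtain w where w: "\<And>y. y \<in> S - line i a \<Longrightarrow> nbhd (w y) \<inter> S = ?C \<union> {x, y}"
    by metis
  have "w y \<in> nbhd x \<inter> line i a" if y: "y \<in> S - line i a" for y
  proof -
    \<comment> \<open>Adjacency to all of \<open>?C\<close>, which has at least \<open>k\<close>
      elements, forces \<open>w y\<close> onto the line.\<close>
    have "x \<in> nbhd (w y)" "?C \<subseteq> nbhd (w y)" using w[OF y] by blast+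
    then show ?thesis
      using nbhd_supset_in_line[OF i _ rich, of a] by (auto simp: in_nbhd_iff)
  qed
  moreover have "inj_on w (S - line i a)"
  proof (rule inj_onI)
    fix y z assume y: "y \<in> S - line i a" and z: "z \<in> S - line i a" and "w y = w z"
    then have "?C \<union> {x, y} = ?C \<union> {x, z}" using w by metis
    then show "y = z" using x y z by blast
  qed
  ultimately have "card (S - line i a) \<le> card (nbhd x \<inter> line i a)"
    by (intro card_inj_on_le) auto
  also have "\<dots> \<le> k - 1"
    using card_nbhd_line_le[OF i] x by blast
  finally show ?thesis using i by linarith
qed

lemma card_shattered_le:
  assumes sh: "shattered (oa_graph M) S"
    and k1: "k = 1 \<Longrightarrow> m \<le> 1" and k2: "k = 2 \<Longrightarrow> m \<le> 3"
  shows "card S \<le> k * (k - 1)"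
proof (rule ccontr)
  assume "\<not> ?thesis"
  then have big: "k * (k - 1) < card S" by simp
  then obtain i u where i: "i < k" and u: "u < m\<^sup>2" "S \<subseteq> nbhd u"
    and rich: "k \<le> card (S \<inter> line i (M $$ (i, u)))"
    by (rule exists_rich_line[OF sh])
  let ?L = "line i (M $$ (i, u))"
  have split: "card S = card (S \<inter> ?L) + card (S - ?L)"
    using card_Int_Diff shattered_finite[OF sh] by blast
  consider "k = 1" | "k = 2" | "3 \<le> k" using i by linarith
  then show False
  proof cases
    case 1
    \<comment> \<open>\<open>s\<close> and \<open>u\<close> are distinct columns, but
      \<open>m \<le> 1\<close> leaves at most one.\<close>
    obtain s where "s \<in> S" using big by fastforce
    then have "s \<in> nbhd u" using u by blast
    then have "s < m\<^sup>2" "s \<noteq> u" by (auto simp: in_nbhd_iff)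
    moreover have "m = 0 \<or> m = 1" using k1[OF 1] by linarith
    ultimately show False using u by auto
  next
    case 2
    obtain w where w: "nbhd w \<inter> S = S \<inter> ?L"
      using shatteredE[OF sh, of "S \<inter> ?L"] by blast
    then have wL: "w \<in> ?L"
      using nbhd_supset_in_line[OF i _ rich] by blast
    have uL: "u \<in> ?L" using u by (simp add: line_def)
    have nS: "u \<notin> S" "w \<notin> S \<inter> ?L"
      using u w by (auto simp: in_nbhd_iff)
    have L: "card ?L \<le> 3"
      using card_line_le[OF i, of "M $$ (i, u)"] k2 2 by simp
    \<comment> \<open>As \<open>u\<close> takes up one of at most three places on \<open>?L\<close>,
      some element of \<open>S\<close> lies off \<open>?L\<close>. It is adjacent to
      \<open>u\<close> but not to \<open>w\<close>, so \<open>u\<close>, \<open>w\<close> and two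
      elements of \<open>S\<close> make four columns on \<open>?L\<close>.\<close>
    have "card (insert u (S \<inter> ?L)) \<le> card ?L"
      using uL by (intro card_mono) auto
    then have "card (S \<inter> ?L) \<le> 2" using L nS by simp
    then have "S \<noteq> S \<inter> ?L" using big 2 by force
    then have "w \<noteq> u" using w u by blast
    moreover have "card (insert w (insert u (S \<inter> ?L))) \<le> card ?L"
      using uL wL by (intro card_mono) auto
    ultimately show False using L nS rich 2 by simp
  next
    case 3
    \<comment> \<open>The two bounds give \<open>card S \<le> (k + 1) + (k - 1) = 2 * k\<close>,
      which is at most \<open>k * (k - 1)\<close> once \<open>k \<ge> 3\<close>. Writing
      \<open>k = l + 3\<close> removes the truncated subtraction.\<close>
    then obtain l where "k = l + 3" by (metis add.commute le_Suc_ex)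
    then show False
      using big split card_shattered_line_le[OF sh i, of "M $$ (i, u)"]
        card_shattered_off_line_less[OF sh i rich]
      by (simp add: algebra_simps)
  qed
qed

end

theorem theorem38:
  fixes k m :: nat and M :: "nat mat"
  assumes "orthogonal_array k m M"
    and "k = 1 \<Longrightarrow> m \<le> 1"
    and "k = 2 \<Longrightarrow> m \<le> 3"
  shows "VC_dim (oa_graph M) \<le> k * (k - 1)"
proof -
  interpret oa k m M by unfold_locales (rule assms(1))
  show ?thesis using assms(2,3) by (intro VC_dim_leI card_shattered_le)
qed

end
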